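(* Let $\{\mathscr P_n:n\ge1\}$ be a sequence of random minimization problems (as defined in the context) satisfying the uniqueness assumption and the regularity assumption, and for each $n$ let $\mathcal J_n=\{J_{n,l}:l\in\mathcal L_n\}$ be perturbation blocks for $\mathscr P_n$, with $m_n=\operatorname{card}(\mathcal L_n)$. Suppose there is a sequence of positive real numbers $\{\theta_n:n\ge1\}$ satisfying the following two conditions. (A) For every $c\in(0,\infty)$ and every $\varepsilon>0$, the sequence of random variables $\{P(\mathcal N_{n,c\theta_n},d_n,\varepsilon):n\ge1\}$ is tight. (B) There are random elements $\{\omega^*_{n,l}:l\in\mathcal L_n\}$ of $\mathcal S_n$, measurable with respect to the $\sigma$-algebra generated by $(\mathbf X^n,\mathbf X^n_l:l\in\mathcal L_n)$, such that $$\max_{l\in\mathcal L_n}d_n\bigl(\widehat\omega_n(\mathbf X^n_l),\omega^*_{n,l}\bigr)\to0\ \text{ in probability as } n\to\infty,$$ and $$\lim_{c\to\infty}\limsup_{n\to\infty}\frac1{m_n}\sum_{l\in\mathcal L_n}\mathbb P\bigl[\psi_n(\mathbf X^n;\omega^*_{n,l})-\psi_{n,\mathrm{opt}}(\mathbf X^n)>c\,\theta_n\bigr]=0.$$ Then $\{\mathscr P_n:n\ge1\}$ is stable under small perturbations with perturbation blocks $\mathcal J_n$.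
   Context: Random minimization problems. $\mathcal X$ is a set with $\sigma$-algebra $\mathcal A$ and $\mathcal P$ a probability measure on $(\mathcal X,\mathcal A)$. For each $n\ge1$, $\mathscr P_n$ has: a finite index set $I_n$ with $k_n=|I_n|\in\mathbb N$; a non-empty compact metric space $(\mathcal S_n,d_n)$ with $\sup_n\operatorname{diam}(\mathcal S_n)<\infty$; and an objective function $\psi_n:\mathcal X^{I_n}\times\mathcal S_n\to\mathbb R$, measurable with respect to $\overline{\mathcal A^{\otimes I_n}}\otimes\mathcal B_n$, where $\overline{\mathcal A^{\otimes I_n}}$ is the completion of $\mathcal A^{\otimes I_n}$ under $\mathcal P^{\otimes I_n}$ and $\mathcal B_n$ is the Borel $\sigma$-algebra of $\mathcal S_n$. The inputs $\mathbf X^n=(X_{n,i})_{i\in I_n}$ are i.i.d. with law $\mathcal P$, and $\mathscr P_n$ is: minimize $\psi_n(\mathbf X^n;\omega)$ over $\omega\in\mathcal S_n$. Put $\psi_{n,\mathrm{opt}}(\mathbf x)=\inf_{\omega\in\mathcal S_n}\psi_n(\mathbf x;\omega)\in[-\infty,\infty)$. Uniqueness assumption: for each $n$, if $\mathscr X_n$ is the set of $\mathbf x\in\mathcal X^{I_n}$ for which there is a unique $\omega^*\in\mathcal S_n$ with $\psi_n(\mathbf x;\omega^* )=\psi_{n,\mathrm{opt}}(\mathbf x)$, then $\mathscr X_n^c$ is a $\mathcal P^{\otimes I_n}$-null set. This unique minimizer is denoted $\widehat\omega_n(\mathbf x)$. Regularity assumption: $\psi_{n,\mathrm{opt}}$ is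 $\overline{\mathcal A^{\otimes I_n}}$-measurable; $\widehat\omega_n:\mathscr X_n\to\mathcal S_n$ is measurable (for the trace of $\overline{\mathcal A^{\otimes I_n}}$ on $\mathscr X_n$ and $\mathcal B_n$); and $\mathbb E[\psi_{n,\mathrm{opt}}(\mathbf X^n)]\in\mathbb R$ for all $n\ge1$. Near-optimal set: $\mathcal N_{n,\theta}=\{\omega\in\mathcal S_n:\psi_n(\mathbf X^n;\omega)\le\psi_{n,\mathrm{opt}}(\mathbf X^n)+\theta\}$ (a random set). Packing number: for a (pseudo-)metric $\mathsf d$, $P(T,\mathsf d,\varepsilon)$ is the largest cardinality of a subset of $T$ whose distinct points have pairwise $\mathsf d$-distance $>\varepsilon$. Perturbation blocks: $\mathcal J_n=\{J_{n,l}:l\in\mathcal L_n\}$ is a family of subsets of $I_n$ (not necessarily disjoint), with $\mathcal L_n$ finite and non-empty, $m_n=\operatorname{card}(\mathcal L_n)$, $\bigcup_{l}J_{n,l}=I_n$. For each $l\in\mathcal L_n$, $\mathbf X^{n,l}=(X^{(l)}_{n,i})_{i\in I_n}$ is an independent copy of $\mathbf X^n$ (no further assumption on the joint law of $(\mathbf X^n,\mathbf X^{n,l}:l\in\mathcal L_n)$), and $\mathbf X^n_l$ is obtained from $\mathbf X^n$ by replacing $X_{n,i}$ by $X^{(l)}_{n,i}$ for $i\in J_{n,l}$. Stability: with $\mathcal O_{n,A}=\{\widehat\omega_n(\mathbf X^n_l):l\in A\}$ for $A\subseteq\mathcal L_n$, the sequence $\{\mathscr P_n\}$ is stable under small perturbations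 with perturbation blocks $\mathcal J_n$ if for any $\varepsilon,\delta>0$ there is $M(\varepsilon,\delta)<\infty$ with $$\limsup_{n\to\infty}\mathbb P\Bigl[\min_{A\subseteq\mathcal L_n:|A|>(1-\varepsilon)m_n}P(\mathcal O_{n,A},d_n,\varepsilon)\ge M(\varepsilon,\delta)\Bigr]\le\delta.$$ *)

theory Defs
  imports "HOL-Probability.Probability" "HOL-Library.Extended_Nat"
begin

definition borel_of :: "'a topology \<Rightarrow> 'a measure" where
  "borel_of T = sigma (topspace T) {U. openin T U}"

text \<open>The largest cardinality of an \<open>\<epsilon>\<close>-separated subset of \<open>T\<close>, which is \<open>\<infinity>\<close> if these
  cardinalities are unbounded.\<close>

definition packing_number :: "'s set \<Rightarrow> ('s \<Rightarrow> 's \<Rightarrow> real) \<Rightarrow> real \<Rightarrow> enat" where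
  "packing_number T d \<epsilon> =
     (SUP F\<in>{F. F \<subseteq> T \<and> finite F \<and> pairwise (\<lambda>x y. d x y > \<epsilon>) F}. enat (card F))"


subsection \<open>Random minimization problems\<close>

definition opt_val :: "'s set \<Rightarrow> ('v \<Rightarrow> 's \<Rightarrow> real) \<Rightarrow> 'v \<Rightarrow> ereal" where
  "opt_val S \<psi> x = (INF \<omega>\<in>S. ereal (\<psi> x \<omega>))"

definition is_minimizer :: "'s set \<Rightarrow> ('v \<Rightarrow> 's \<Rightarrow> real) \<Rightarrow> 'v \<Rightarrow> 's \<Rightarrow> bool" where
  "is_minimizer S \<psi> x \<omega> \<longleftrightarrow> \<omega> \<in> S \<and> ereal (\<psi> x \<omega>) = opt_val S \<psi> x"

text \<open>Meaningful only where the minimizer is unique; elsewhere the value is unspecified (and need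
  not lie in \<open>S\<close>).\<close>

definition minimizer :: "'s set \<Rightarrow> ('v \<Rightarrow> 's \<Rightarrow> real) \<Rightarrow> 'v \<Rightarrow> 's" where
  "minimizer S \<psi> x = (THE \<omega>. is_minimizer S \<psi> x \<omega>)"

definition near_opt_set :: "'s set \<Rightarrow> ('v \<Rightarrow> 's \<Rightarrow> real) \<Rightarrow> real \<Rightarrow> 'v \<Rightarrow> 's set" where
  "near_opt_set S \<psi> \<theta> x = {\<omega> \<in> S. ereal (\<psi> x \<omega>) \<le> opt_val S \<psi> x + ereal \<theta>}"

locale random_min_problem =
  prob_space P + Metric_space S d
  for P :: "'x measure" and I :: "'i set" and S :: "'s set" and d :: "'s \<Rightarrow> 's \<Rightarrow> real"
    and \<psi> :: "('i \<Rightarrow> 'x) \<Rightarrow> 's \<Rightarrow> real" +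
  assumes finite_index: "finite I"
    and nonempty: "S \<noteq> {}"
    and compact: "compact_space mtopology"
    and objective_measurable:
      "(\<lambda>(x, \<omega>). \<psi> x \<omega>) \<in>
         borel_measurable (completion (PiM I (\<lambda>_. P)) \<Otimes>\<^sub>M borel_of mtopology)"

definition unique_set ::
  "'x measure \<Rightarrow> 'i set \<Rightarrow> 's set \<Rightarrow> (('i \<Rightarrow> 'x) \<Rightarrow> 's \<Rightarrow> real) \<Rightarrow> ('i \<Rightarrow> 'x) set" where
  "unique_set P I S \<psi> = {x \<in> space (PiM I (\<lambda>_. P)). \<exists>!\<omega>. is_minimizer S \<psi> x \<omega>}"

definition uniqueness_assumption ::
  "'x measure \<Rightarrow> 'i set \<Rightarrow> 's set \<Rightarrow> (('i \<Rightarrow> 'x) \<Rightarrow> 's \<Rightarrow> real) \<Rightarrow> bool" where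
  "uniqueness_assumption P I S \<psi> \<longleftrightarrow>
     space (PiM I (\<lambda>_. P)) - unique_set P I S \<psi> \<in> null_sets (completion (PiM I (\<lambda>_. P)))"

text \<open>The last two conjuncts say that the extended real valued function \<open>opt_val S \<psi>\<close> has a finite
  expectation under the input law: its positive and its negative part have finite integrals.\<close>

definition regularity_assumption ::
  "'x measure \<Rightarrow> 'i set \<Rightarrow> 's set \<Rightarrow> ('s \<Rightarrow> 's \<Rightarrow> real) \<Rightarrow>
   (('i \<Rightarrow> 'x) \<Rightarrow> 's \<Rightarrow> real) \<Rightarrow> bool" where
  "regularity_assumption P I S d \<psi> \<longleftrightarrow>
     opt_val S \<psi> \<in> borel_measurable (completion (PiM I (\<lambda>_. P))) \<and>
     minimizer S \<psi> \<in>
       restrict_space (completion (PiM I (\<lambda>_. P))) (unique_set P I S \<psi>)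
         \<rightarrow>\<^sub>M borel_of (Metric_space.mtopology S d) \<and>
     (\<integral>\<^sup>+ x. e2ennreal (opt_val S \<psi> x) \<partial>completion (PiM I (\<lambda>_. P))) < \<infinity> \<and>
     (\<integral>\<^sup>+ x. e2ennreal (- opt_val S \<psi> x) \<partial>completion (PiM I (\<lambda>_. P))) < \<infinity>"


subsection \<open>Inputs and their perturbations\<close>

text \<open>Measurability of the coordinates is part of \<open>indep_vars\<close> and \<open>indep_var\<close>.\<close>

definition iid_inputs ::
  "'w measure \<Rightarrow> 'x measure \<Rightarrow> 'i set \<Rightarrow> ('i \<Rightarrow> 'w \<Rightarrow> 'x) \<Rightarrow> bool" where
  "iid_inputs \<Omega> P I X \<longleftrightarrow>
     prob_space.indep_vars \<Omega> (\<lambda>_. P) X I \<and> (\<forall>i\<in>I. distr \<Omega> P (X i) = P)"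

definition input_vec :: "'i set \<Rightarrow> ('i \<Rightarrow> 'w \<Rightarrow> 'x) \<Rightarrow> 'w \<Rightarrow> 'i \<Rightarrow> 'x" where
  "input_vec I X w = (\<lambda>i\<in>I. X i w)"

definition independent_copy ::
  "'w measure \<Rightarrow> 'x measure \<Rightarrow> 'i set \<Rightarrow> ('i \<Rightarrow> 'w \<Rightarrow> 'x) \<Rightarrow> ('i \<Rightarrow> 'w \<Rightarrow> 'x) \<Rightarrow> bool" where
  "independent_copy \<Omega> P I X X' \<longleftrightarrow>
     prob_space.indep_var \<Omega> (PiM I (\<lambda>_. P)) (input_vec I X) (PiM I (\<lambda>_. P)) (input_vec I X') \<and>
     distr \<Omega> (PiM I (\<lambda>_. P)) (input_vec I X') = distr \<Omega> (PiM I (\<lambda>_. P)) (input_vec I X)"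

definition perturbed_vec ::
  "'i set \<Rightarrow> 'i set \<Rightarrow> ('i \<Rightarrow> 'w \<Rightarrow> 'x) \<Rightarrow> ('i \<Rightarrow> 'w \<Rightarrow> 'x) \<Rightarrow> 'w \<Rightarrow> 'i \<Rightarrow> 'x" where
  "perturbed_vec I J X X' = input_vec I (\<lambda>i w. if i \<in> J then X' i w else X i w)"

definition perturbation_blocks :: "'i set \<Rightarrow> 'l set \<Rightarrow> ('l \<Rightarrow> 'i set) \<Rightarrow> bool" where
  "perturbation_blocks I L J \<longleftrightarrow> finite L \<and> L \<noteq> {} \<and> (\<Union>l\<in>L. J l) = I"

definition perturbation_algebra ::
  "'w measure \<Rightarrow> 'x measure \<Rightarrow> 'i set \<Rightarrow> 'l set \<Rightarrow> ('l \<Rightarrow> 'i set) \<Rightarrow>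
   ('i \<Rightarrow> 'w \<Rightarrow> 'x) \<Rightarrow> ('l \<Rightarrow> 'i \<Rightarrow> 'w \<Rightarrow> 'x) \<Rightarrow> 'w measure" where
  "perturbation_algebra \<Omega> P I L J X X' =
     vimage_algebra (space \<Omega>)
       (\<lambda>w. (input_vec I X w, \<lambda>l\<in>L. perturbed_vec I (J l) X (X' l) w))
       (PiM I (\<lambda>_. P) \<Otimes>\<^sub>M PiM L (\<lambda>_. PiM I (\<lambda>_. P)))"


subsection \<open>Tightness and stability\<close>

text \<open>Sequences start at index 1. Tightness is stated through the outer measure, which is the
  (completed) probability whenever \<open>Y n\<close> is measurable with respect to the completion. The
  packing numbers of near-optimal sets are so measurable, but only by the measurable projection
  theorem; the plain \<open>measure\<close> would give the value 0 to an event not known to be measurable.\<close>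

definition tight_sequence :: "(nat \<Rightarrow> 'w measure) \<Rightarrow> (nat \<Rightarrow> 'w \<Rightarrow> enat) \<Rightarrow> bool" where
  "tight_sequence \<Omega> Y \<longleftrightarrow>
     (\<forall>\<eta>>0. \<exists>K::nat. \<forall>n\<ge>1.
        outer_measure_of (\<Omega> n) {w \<in> space (\<Omega> n). Y n w > enat K} \<le> ennreal \<eta>)"

text \<open>Since minimizers are only measurable with respect to the completed product measure, the
  events below live in the completion of the underlying probability space.\<close>

definition stable_under_small_perturbations ::
  "(nat \<Rightarrow> 'w measure) \<Rightarrow> (nat \<Rightarrow> 'i set) \<Rightarrow> (nat \<Rightarrow> 's set) \<Rightarrow> (nat \<Rightarrow> 's \<Rightarrow> 's \<Rightarrow> real) \<Rightarrow>
   (nat \<Rightarrow> ('i \<Rightarrow> 'x) \<Rightarrow> 's \<Rightarrow> real) \<Rightarrow> (nat \<Rightarrow> 'l set) \<Rightarrow> (nat \<Rightarrow> 'l \<Rightarrow> 'i set) \<Rightarrow>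
   (nat \<Rightarrow> 'i \<Rightarrow> 'w \<Rightarrow> 'x) \<Rightarrow> (nat \<Rightarrow> 'l \<Rightarrow> 'i \<Rightarrow> 'w \<Rightarrow> 'x) \<Rightarrow> bool" where
  "stable_under_small_perturbations \<Omega> I S d \<psi> L J X X' \<longleftrightarrow>
     (\<forall>\<epsilon>>0. \<forall>\<delta>>0. \<exists>K::nat.
        limsup (\<lambda>n. ereal (measure (completion (\<Omega> n))
          {w \<in> space (\<Omega> n).
             (MIN A\<in>{A. A \<subseteq> L n \<and> real (card A) > (1 - \<epsilon>) * real (card (L n))}.
                packing_number
                  ((\<lambda>l. minimizer (S n) (\<psi> n) (perturbed_vec (I n) (J n l) (X n) (X' n l) w)) ` A)
                  (d n) \<epsilon>) \<ge> enat K}))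
        \<le> ereal \<delta>)"

end

(* On the event that every guess omega*_l is within epsilon/4 of the minimizer of the l-th perturbed
   problem, an epsilon-separated set of perturbed minimizers yields an equally large
   epsilon/2-separated set of guesses. By Markov's inequality, with high probability all but a
   fraction epsilon of the guesses are c theta_n-optimal for the unperturbed problem once c is large,
   so the packing number of the corresponding perturbed minimizers is at most that of the near-optimal
   set at scale epsilon/2, which is tight.

   The measurability work is needed because both assumptions in (B) are about values of measure,
   which is 0 on non-measurable sets. The minimizers are only measurable for the completed input law;
   this passes to perturbed inputs because they have the same law as the original input. *)
theory Submission imports Defs begin

section \<open>Comparison of packing numbers\<close>

lemma card_le_packing_number:
  assumes "F \<subseteq> T" "finite F" "pairwise (\<lambda>x y. d x y > \<epsilon>) F"
  shows "enat (card F) \<le> packing_number T d \<epsilon>"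
  unfolding packing_number_def using assms by (intro SUP_upper) auto

text \<open>Going from \<open>f k\<close> to \<open>f l\<close> through \<open>g k\<close> and
  \<open>g l\<close> costs at most \<epsilon>/4 at either end, so points \<open>f k\<close>,
  \<open>f l\<close> more than \<epsilon> apart force \<open>g k\<close>, \<open>g l\<close> to be
  more than \<epsilon>/2 apart. In particular distinct indices keep distinct images under
  \<open>g\<close>, and no points are lost in the count.\<close>

lemma (in Metric_space) packing_number_image_le:
  assumes \<epsilon>: "\<epsilon> > 0" and T: "T \<subseteq> M" and f: "\<And>l. l \<in> A \<Longrightarrow> f l \<in> M"
    and g: "\<And>l. l \<in> A \<Longrightarrow> g l \<in> T" and close: "\<And>l. l \<in> A \<Longrightarrow> d (f l) (g l) \<le> \<epsilon> / 4"
  shows "packing_number (f ` A) d \<epsilon> \<le> packing_number T d (\<epsilon> / 2)"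
  unfolding packing_number_def[of "f ` A"]
proof (rule SUP_least, clarify)
  fix F assume F: "F \<subseteq> f ` A" "finite F" "pairwise (\<lambda>x y. \<epsilon> < d x y) F"
  \<comment> \<open>The map \<open>f\<close> may identify indices, so one index is selected for each
    point of \<open>F\<close>.\<close>
  then obtain B where B: "B \<subseteq> A" "inj_on f B" "F = f ` B"
    by (meson subset_image_inj)
  have far: "d (g k) (g l) > \<epsilon> / 2" if "k \<in> B" "l \<in> B" "k \<noteq> l" for k l
  proof -
    have in_M: "f k \<in> M" "f l \<in> M" "g k \<in> M" "g l \<in> M"
      using that B(1) f g T by auto
    have "\<epsilon> < d (f k) (f l)"
      using that B(1,2) F(3) unfolding B(3) pairwise_def by (auto dest: inj_onD)
    also have "\<dots> \<le> d (f k) (g k) + (d (g k) (g l) + d (g l) (f l))"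
      by (meson in_M triangle add_left_mono order_trans)
    also have "\<dots> \<le> \<epsilon> / 4 + (d (g k) (g l) + \<epsilon> / 4)"
      using close[of k] close[of l] that B(1) by (intro add_mono) (auto simp: commute[of "g l"])
    finally show ?thesis by simp
  qed
  have "inj_on g B"
  proof (rule inj_onI, rule ccontr)
    fix k l assume kl: "k \<in> B" "l \<in> B" "g k = g l" "k \<noteq> l"
    then have "g l \<in> M"
      using B(1) g T by auto
    then show False
      using far[OF kl(1,2,4)] kl(3) \<epsilon> by simp
  qed
  then have "card F = card (g ` B)"
    using B by (simp add: card_image)
  also have "enat \<dots> \<le> packing_number T d (\<epsilon> / 2)"
    using F(2) B g far
    by (intro card_le_packing_number) (auto simp: pairwise_def finite_image_iff)
  finally show "enat (card F) \<le> packing_number T d (\<epsilon> / 2)" .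
qed

section \<open>Measurability of distances in a compact metric space\<close>

lemma space_borel_of [simp]: "space (borel_of T) = topspace T"
  unfolding borel_of_def by (rule space_measure_of) (auto dest: openin_subset)

lemma openin_in_borel_of: "openin T U \<Longrightarrow> U \<in> sets (borel_of T)"
  unfolding borel_of_def by (subst sets_measure_of) (auto dest: openin_subset)

lemma (in Metric_space) measurable_dist_const:
  assumes f: "f \<in> N \<rightarrow>\<^sub>M borel_of mtopology" and q: "q \<in> M"
  shows "(\<lambda>w. d (f w) q) \<in> borel_measurable N"
proof (subst borel_measurable_iff_less, rule allI)
  fix a
  have "mball q a \<in> sets (borel_of mtopology)"
    by (simp add: openin_in_borel_of)
  from measurable_sets[OF f this]
  have "f -` mball q a \<inter> space N \<in> sets N" .
  also have "f -` mball q a \<inter> space N = {w \<in> space N. d (f w) q < a}"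
    using measurable_space[OF f] q by (auto simp: commute)
  finally show "{w \<in> space N. d (f w) q < a} \<in> sets N" .
qed

text \<open>Total boundedness provides a finite net of radius 1/(n+1) for every n; the union of
  these nets is dense.\<close>

lemma (in Metric_space) compact_space_imp_countable_dense:
  assumes "compact_space mtopology"
  obtains D where "countable D" "D \<subseteq> M" "\<And>x e. x \<in> M \<Longrightarrow> e > 0 \<Longrightarrow> \<exists>q\<in>D. d x q < e"
proof -
  have "mtotally_bounded M"
    using assms compact_space_eq_mcomplete_mtotally_bounded by blast
  then have "\<exists>K. finite K \<and> K \<subseteq> M \<and> M \<subseteq> (\<Union>x\<in>K. mball x (inverse (Suc n)))" for n
    by (auto simp: mtotally_bounded_def)
  then obtain K where K: "\<And>n. finite (K n)" "\<And>n. K n \<subseteq> M"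
    "\<And>n. M \<subseteq> (\<Union>x\<in>K n. mball x (inverse (Suc n)))"
    by metis
  show thesis
  proof
    show "countable (\<Union>n. K n)" "(\<Union>n. K n) \<subseteq> M"
      using K by (auto intro: countable_finite)
    fix x and e :: real assume x: "x \<in> M" and "e > 0"
    then obtain n where n: "inverse (Suc n) < e"
      using reals_Archimedean by blast
    obtain q where "q \<in> K n" "d q x < inverse (Suc n)"
      using K(3)[of n] x by auto
    then show "\<exists>q\<in>\<Union>n. K n. d x q < e"
      using n commute[of q x] by (intro bexI[of _ q]) auto
  qed
qed

text \<open>Separability reduces the joint distance to distances from fixed points:
  \<open>d (f w) (g w) < a\<close> holds iff some \<open>q\<close> in a countable dense set
  satisfies \<open>d (f w) q + d (g w) q < a\<close>. This avoids comparing the Borel sets of the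
  product space with the product \<sigma>-algebra.\<close>

lemma (in Metric_space) measurable_dist:
  assumes compact: "compact_space mtopology"
    and f: "f \<in> N \<rightarrow>\<^sub>M borel_of mtopology" and g: "g \<in> N \<rightarrow>\<^sub>M borel_of mtopology"
  shows "(\<lambda>w. d (f w) (g w)) \<in> borel_measurable N"
proof (subst borel_measurable_iff_less, rule allI)
  fix a
  obtain D where D: "countable D" "D \<subseteq> M" "\<And>x e. x \<in> M \<Longrightarrow> e > 0 \<Longrightarrow> \<exists>q\<in>D. d x q < e"
    by (rule compact_space_imp_countable_dense[OF compact]) blast
  have "(\<exists>q\<in>D. d (f w) q + d (g w) q < a) \<longleftrightarrow> d (f w) (g w) < a" if "w \<in> space N" for w
  proof -
    have in_M: "f w \<in> M" "g w \<in> M"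
      using that measurable_space[OF f] measurable_space[OF g] by auto
    have "d (f w) (g w) \<le> d (f w) q + d (g w) q" if "q \<in> D" for q
      using triangle[of "f w" q "g w"] commute[of q "g w"] that D(2) in_M by auto
    moreover have "\<exists>q\<in>D. d (f w) q + d (g w) q < a" if less: "d (f w) (g w) < a"
    proof -
      \<comment> \<open>The distance through \<open>q\<close> exceeds the direct one by at most
        \<open>2 * d (g w) q\<close>, hence the choice of half the gap.\<close>
      obtain q where q: "q \<in> D" "d (g w) q < (a - d (f w) (g w)) / 2"
        using D(3)[of "g w" "(a - d (f w) (g w)) / 2"] in_M less by auto
      moreover have "d (f w) q \<le> d (f w) (g w) + d (g w) q"
        using triangle[of "f w" "g w" q] q(1) D(2) in_M by auto
      ultimately show ?thesis by (intro bexI[of _ q]) (auto simp: field_simps)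
    qed
    ultimately show ?thesis by force
  qed
  then have "{w \<in> space N. d (f w) (g w) < a} =
      {w \<in> space N. \<exists>q\<in>D. d (f w) q + d (g w) q < a}"
    by auto
  also have "\<dots> = (\<Union>q\<in>D. {w \<in> space N. d (f w) q + d (g w) q < a})"
    by auto
  also have "\<dots> \<in> sets N"
  proof (rule sets.countable_UN''[OF D(1)])
    fix q assume "q \<in> D"
    then have [measurable]: "(\<lambda>w. d (f w) q) \<in> borel_measurable N"
        "(\<lambda>w. d (g w) q) \<in> borel_measurable N"
      using D(2) measurable_dist_const[OF f] measurable_dist_const[OF g] by auto
    show "{w \<in> space N. d (f w) q + d (g w) q < a} \<in> sets N"
      by measurable
  qed
  finally show "{w \<in> space N. d (f w) (g w) < a} \<in> sets N" .
qed

section \<open>Laws of the inputs and of the perturbed inputs\<close>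

text \<open>Since \<open>f\<close> carries \<open>M\<close> to the law \<open>N\<close>, preimages
  of \<open>N\<close>-null sets are \<open>M\<close>-null, so the null sets added on the target side
  pull back to sets of the completed source.\<close>

lemma measurable_completion_completion:
  assumes f: "f \<in> M \<rightarrow>\<^sub>M N" and distr: "distr M N f = N"
  shows "f \<in> completion M \<rightarrow>\<^sub>M completion N"
  using f distr distr_completion[OF f]
  by (intro completion.measurable_completion2) (auto simp: measurable_completion)

lemma (in prob_space) distr_input_vec:
  assumes P: "prob_space P" and I: "finite I" and iid: "iid_inputs M P I X"
  shows "input_vec I X \<in> M \<rightarrow>\<^sub>M PiM I (\<lambda>_. P)"
    and "distr M (PiM I (\<lambda>_. P)) (input_vec I X) = PiM I (\<lambda>_. P)"
proof -
  interpret P: prob_space P by fact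
  interpret PP: product_prob_space "\<lambda>_. P" by unfold_locales
  have X: "X i \<in> M \<rightarrow>\<^sub>M P" if "i \<in> I" for i
    using iid that by (auto simp: iid_inputs_def indep_vars_def2)
  then show meas: "input_vec I X \<in> M \<rightarrow>\<^sub>M PiM I (\<lambda>_. P)"
    by (auto simp: input_vec_def[abs_def] intro!: measurable_restrict)
  show "distr M (PiM I (\<lambda>_. P)) (input_vec I X) = PiM I (\<lambda>_. P)"
  proof (cases "I = {}")
    \<comment> \<open>The characterization of independence by product laws, used in the other case,
      is for nonempty index sets. With no coordinates the product space is a single point, to which
      both measures give mass 1.\<close>
    case True
    show ?thesis
    proof (rule PP.PiM_eqI[OF I])
      fix A :: "_ \<Rightarrow> _ set"
      have "input_vec I X -` ({\<lambda>x. undefined}) \<inter> space M = space M"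
        using True by (auto simp: input_vec_def)
      then show "emeasure (distr M (PiM I (\<lambda>_. P)) (input_vec I X)) (Pi\<^sub>E I A) =
          (\<Prod>i\<in>I. emeasure P (A i))"
        using True meas by (subst emeasure_distr) (auto simp: emeasure_space_1 sets_PiM_empty)
    qed simp
  next
    case False
    have "distr M (PiM I (\<lambda>_. P)) (\<lambda>w. \<lambda>i\<in>I. X i w) = PiM I (\<lambda>i. distr M P (X i))"
      using iid X by (subst indep_vars_iff_distr_eq_PiM'[OF False, symmetric])
        (auto simp: iid_inputs_def)
    also have "\<dots> = PiM I (\<lambda>_. P)"
      using iid by (intro PiM_cong) (auto simp: iid_inputs_def)
    finally show ?thesis
      by (simp add: input_vec_def[abs_def])
  qed
qed

text \<open>Resampling the coordinates in \<open>J\<close> from an independent copy leaves a product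
  law unchanged. It suffices to test boxes, whose preimages under the merging map are again products
  of boxes.\<close>

lemma distr_merge_product:
  fixes I J :: "'i set" and P :: "'x measure"
  assumes P: "prob_space P" and I: "finite I"
  defines "N \<equiv> PiM I (\<lambda>_. P)" and "g \<equiv> \<lambda>(x, y). \<lambda>i\<in>I. if i \<in> J then y i else x i"
  shows "g \<in> N \<Otimes>\<^sub>M N \<rightarrow>\<^sub>M N" and "distr (N \<Otimes>\<^sub>M N) N g = N"
proof -
  interpret P: prob_space P by fact
  interpret PP: product_prob_space "\<lambda>_. P" by unfold_locales
  interpret N: prob_space N
    unfolding N_def using P by (rule prob_space_PiM)
  show meas: "g \<in> N \<Otimes>\<^sub>M N \<rightarrow>\<^sub>M N"
    unfolding g_def N_def split_beta'
  proof (rule measurable_restrict)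
    fix i assume [simp]: "i \<in> I"
    show "(\<lambda>p. if i \<in> J then snd p i else fst p i) \<in> PiM I (\<lambda>_. P) \<Otimes>\<^sub>M PiM I (\<lambda>_. P) \<rightarrow>\<^sub>M P"
      by (cases "i \<in> J") simp_all
  qed
  show "distr (N \<Otimes>\<^sub>M N) N g = N"
    unfolding N_def
  proof (rule PP.PiM_eqI[OF I], fold N_def)
    fix A :: "_ \<Rightarrow> _ set" assume A: "\<And>i. i \<in> I \<Longrightarrow> A i \<in> sets P"
    \<comment> \<open>Each copy is constrained only in the coordinates taken from it. In every
      coordinate one of the two factors is therefore the full space, of mass 1.\<close>
    define B where "B = Pi\<^sub>E I (\<lambda>i. if i \<in> J then space P else A i)"
    define C where "C = Pi\<^sub>E I (\<lambda>i. if i \<in> J then A i else space P)"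
    have BC: "B \<in> sets N" "C \<in> sets N"
      unfolding B_def C_def N_def using A I by (auto intro!: sets_PiM_I_finite)
    have "g -` Pi\<^sub>E I A \<inter> space (N \<Otimes>\<^sub>M N) = B \<times> C"
      using sets.sets_into_space[OF A]
      by (fastforce simp: g_def B_def C_def N_def space_pair_measure space_PiM PiE_iff
          split: if_splits)
    then have "emeasure (distr (N \<Otimes>\<^sub>M N) N g) (Pi\<^sub>E I A) = emeasure (N \<Otimes>\<^sub>M N) (B \<times> C)"
      using A I meas by (subst emeasure_distr) (auto simp: N_def intro!: sets_PiM_I_finite)
    also have "\<dots> = emeasure N B * emeasure N C"
      using BC by (rule N.emeasure_pair_measure_Times)
    also have "\<dots> = (\<Prod>i\<in>I. emeasure P (if i \<in> J then space P else A i)) *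
        (\<Prod>i\<in>I. emeasure P (if i \<in> J then A i else space P))"
      unfolding B_def C_def N_def using A I by (subst (1 2) PP.emeasure_PiM) auto
    also have "\<dots> = (\<Prod>i\<in>I. emeasure P (A i))"
      unfolding prod.distrib[symmetric] by (intro prod.cong) (auto simp: P.emeasure_space_1)
    finally show "emeasure (distr (N \<Otimes>\<^sub>M N) N g) (Pi\<^sub>E I A) = (\<Prod>i\<in>I. emeasure P (A i))" .
  qed (simp add: N_def)
qed

text \<open>By independence the input and its copy have the product law jointly, and the perturbed
  vector is the image of this pair under the merging map.\<close>

lemma (in prob_space) distr_perturbed_vec:
  assumes P: "prob_space P" and I: "finite I" and iid: "iid_inputs M P I X"
    and copy: "independent_copy M P I X X'"
  shows "perturbed_vec I J X X' \<in> M \<rightarrow>\<^sub>M PiM I (\<lambda>_. P)"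
    and "distr M (PiM I (\<lambda>_. P)) (perturbed_vec I J X X') = PiM I (\<lambda>_. P)"
proof -
  let ?N = "PiM I (\<lambda>_. P)"
  define g where "g = (\<lambda>(x, y). \<lambda>i\<in>I. if i \<in> J then y i else x i :: 'b)"
  define h where "h = (\<lambda>w. (input_vec I X w, input_vec I X' w))"
  note g = distr_merge_product[OF P I, of J, folded g_def]
  have indep: "indep_var ?N (input_vec I X) ?N (input_vec I X')"
    using copy by (simp add: independent_copy_def)
  have h: "h \<in> M \<rightarrow>\<^sub>M ?N \<Otimes>\<^sub>M ?N"
    using indep unfolding indep_var_distribution_eq h_def by auto
  have "distr M (?N \<Otimes>\<^sub>M ?N) h = ?N \<Otimes>\<^sub>M ?N"
    using indep copy distr_input_vec(2)[OF P I iid]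
    unfolding indep_var_distribution_eq h_def independent_copy_def by auto
  then have "distr M ?N (g \<circ> h) = ?N"
    using distr_distr[OF g(1) h] g(2) by simp
  moreover have "perturbed_vec I J X X' = g \<circ> h"
    by (auto simp: perturbed_vec_def g_def h_def input_vec_def fun_eq_iff)
  ultimately show "perturbed_vec I J X X' \<in> M \<rightarrow>\<^sub>M ?N"
    "distr M ?N (perturbed_vec I J X X') = ?N"
    using measurable_comp[OF h g(1)] by simp_all
qed

section \<open>Markov bound for the number of events that occur\<close>

text \<open>Markov's inequality for the sum of the indicators, normalized so that the average of the
  probabilities appears as in condition (B). The events may depend on each other
  arbitrarily.\<close>

lemma (in prob_space) prob_card_members_ge_le:
  fixes \<epsilon> :: real
  assumes L: "finite L" "L \<noteq> {}" and \<epsilon>: "\<epsilon> > 0"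
    and B: "\<And>l. l \<in> L \<Longrightarrow> B l \<in> events"
  shows "{w \<in> space M. real (card {l \<in> L. w \<in> B l}) \<ge> \<epsilon> * card L} \<in> events"
    and "prob {w \<in> space M. real (card {l \<in> L. w \<in> B l}) \<ge> \<epsilon> * card L}
         \<le> (1 / card L * (\<Sum>l\<in>L. prob (B l))) / \<epsilon>"
proof -
  have card_eq: "real (card {l \<in> L. w \<in> B l}) = (\<Sum>l\<in>L. indicator (B l) w)" for w
    using L by (simp add: indicator_def sum.If_cases Int_def)
  have int: "integrable M (\<lambda>w. \<Sum>l\<in>L. indicator (B l) w :: real)"
    using B by (intro Bochner_Integration.integrable_sum) (auto simp: emeasure_eq_measure)
  show "{w \<in> space M. real (card {l \<in> L. w \<in> B l}) \<ge> \<epsilon> * card L} \<in> events"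
    unfolding card_eq using borel_measurable_integrable[OF int] by measurable
  have "prob {w \<in> space M. real (card {l \<in> L. w \<in> B l}) \<ge> \<epsilon> * card L}
      \<le> (\<integral>w. (\<Sum>l\<in>L. indicator (B l) w) \<partial>M) / (\<epsilon> * card L)"
    unfolding card_eq using L \<epsilon> int
    by (intro integral_Markov_inequality_measure[where A = "space M"])
      (auto intro!: sum_nonneg mult_pos_pos simp: card_gt_0_iff)
  also have "(\<integral>w. (\<Sum>l\<in>L. indicator (B l) w) \<partial>M) = (\<Sum>l\<in>L. prob (B l))"
    using B by (subst Bochner_Integration.integral_sum)
      (auto simp: emeasure_eq_measure sets.Int_space_eq2 intro!: sum.cong)
  finally show "prob {w \<in> space M. real (card {l \<in> L. w \<in> B l}) \<ge> \<epsilon> * card L}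
      \<le> (1 / card L * (\<Sum>l\<in>L. prob (B l))) / \<epsilon>"
    by (simp add: field_simps)
qed

section \<open>Estimates for a single problem and its perturbations\<close>

text \<open>Gathers the assumptions that concern one index n. Tightness and the two limits in (B)
  stay outside, so every bound derived here is non-asymptotic.\<close>

locale perturbed_problem = random_min_problem P I S d \<psi> + \<Omega>: prob_space \<Omega>
  for P :: "'x measure" and I :: "'i set" and S :: "'s set" and d :: "'s \<Rightarrow> 's \<Rightarrow> real"
    and \<psi> :: "('i \<Rightarrow> 'x) \<Rightarrow> 's \<Rightarrow> real" and \<Omega> :: "'w measure" +
  fixes L :: "'l set" and J :: "'l \<Rightarrow> 'i set"
    and X :: "'i \<Rightarrow> 'w \<Rightarrow> 'x" and X' :: "'l \<Rightarrow> 'i \<Rightarrow> 'w \<Rightarrow> 'x" and \<omega>s :: "'l \<Rightarrow> 'w \<Rightarrow> 's"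
  assumes uniqueness: "uniqueness_assumption P I S \<psi>"
    and regularity: "regularity_assumption P I S d \<psi>"
    and inputs: "iid_inputs \<Omega> P I X"
    and blocks: "perturbation_blocks I L J"
    and copies: "\<And>l. l \<in> L \<Longrightarrow> independent_copy \<Omega> P I X (X' l)"
    and guess_measurable: "\<And>l. l \<in> L \<Longrightarrow>
      \<omega>s l \<in> perturbation_algebra \<Omega> P I L J X X' \<rightarrow>\<^sub>M borel_of mtopology"
begin

abbreviation "input_law \<equiv> PiM I (\<lambda>_. P)"
abbreviation "perturbed l \<equiv> perturbed_vec I (J l) X (X' l)"
abbreviation "perturbed_minimizer l w \<equiv> minimizer S \<psi> (perturbed l w)"

text \<open>Off this almost sure event some \<open>perturbed_minimizer l w\<close> may be an
  unspecified value outside \<open>S\<close>.\<close>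

definition unique_event :: "'w set" where
  "unique_event = {w \<in> space \<Omega>. \<forall>l\<in>L. perturbed l w \<in> unique_set P I S \<psi>}"

definition far_event :: "real \<Rightarrow> 'w set" where
  "far_event e = {w \<in> space \<Omega>. (MAX l\<in>L. d (perturbed_minimizer l w) (\<omega>s l w)) > e}"

text \<open>The difference is taken in the extended reals: where the infimum is -\<infinity> it
  equals \<infinity>, and the event occurs.\<close>

definition suboptimal_event :: "real \<Rightarrow> 'l \<Rightarrow> 'w set" where
  "suboptimal_event t l = {w \<in> space \<Omega>.
     ereal (\<psi> (input_vec I X w) (\<omega>s l w)) - opt_val S \<psi> (input_vec I X w) > ereal t}"

lemma L: "finite L" "L \<noteq> {}"
  using blocks by (auto simp: perturbation_blocks_def)

lemma input_vec_law:
  "input_vec I X \<in> \<Omega> \<rightarrow>\<^sub>M input_law" "distr \<Omega> input_law (input_vec I X) = input_law"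
  using \<Omega>.distr_input_vec[OF prob_space_axioms finite_index inputs] by auto

lemma perturbed_law:
  assumes "l \<in> L"
  shows "perturbed l \<in> \<Omega> \<rightarrow>\<^sub>M input_law" "distr \<Omega> input_law (perturbed l) = input_law"
  using \<Omega>.distr_perturbed_vec[OF prob_space_axioms finite_index inputs copies[OF assms]] by auto

lemma guess_measurable_completion:
  assumes "l \<in> L"
  shows "\<omega>s l \<in> completion \<Omega> \<rightarrow>\<^sub>M borel_of mtopology"
proof -
  have "(\<lambda>w. (input_vec I X w, \<lambda>l\<in>L. perturbed l w))
      \<in> \<Omega> \<rightarrow>\<^sub>M input_law \<Otimes>\<^sub>M PiM L (\<lambda>_. input_law)"
    using input_vec_law(1) perturbed_law(1) by (intro measurable_Pair measurable_restrict)
  \<comment> \<open>A map is measurable only if the \<sigma>-algebra it generates lies in that of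
    its source, so the guesses are random elements on \<Omega> itself.\<close>
  then have "sets (perturbation_algebra \<Omega> P I L J X X') \<subseteq> sets \<Omega>"
    unfolding perturbation_algebra_def measurable_iff_sets by simp
  then have "\<omega>s l \<in> \<Omega> \<rightarrow>\<^sub>M borel_of mtopology"
    using guess_measurable[OF assms] measurable_mono[of "borel_of mtopology" "borel_of mtopology"
        "perturbation_algebra \<Omega> P I L J X X'" \<Omega>]
    by (auto simp: perturbation_algebra_def)
  then show ?thesis
    by (rule measurable_completion)
qed

lemma guess_in_S: "l \<in> L \<Longrightarrow> w \<in> space \<Omega> \<Longrightarrow> \<omega>s l w \<in> S"
  using measurable_space[OF guess_measurable_completion, of l w] by simp

text \<open>Each perturbed input has the input law, so the exceptional set of the uniqueness
  assumption pulls back to a null set for every \<open>l\<close>, and there are finitely many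
  \<open>l\<close>.\<close>

lemma non_unique_null: "space \<Omega> - unique_event \<in> null_sets (completion \<Omega>)"
proof -
  let ?N = "space input_law - unique_set P I S \<psi>"
  \<comment> \<open>The exceptional set is null only for the completed law; a measurable null cover
    can be pulled back along the uncompleted law.\<close>
  obtain N where N: "N \<in> null_sets input_law" "?N \<subseteq> N"
    using uniqueness by (auto simp: uniqueness_assumption_def null_sets_completion_iff2)
  have "perturbed l -` ?N \<inter> space \<Omega> \<in> null_sets (completion \<Omega>)" if "l \<in> L" for l
  proof (rule null_sets_completion_subset)
    show "perturbed l -` ?N \<inter> space \<Omega> \<subseteq> perturbed l -` N \<inter> space \<Omega>"
      using N(2) by auto
    have "N \<in> null_sets (distr \<Omega> input_law (perturbed l))"
      using N(1) perturbed_law(2)[OF that] by simp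
    then show "perturbed l -` N \<inter> space \<Omega> \<in> null_sets (completion \<Omega>)"
      using null_sets_distr_iff[OF perturbed_law(1)[OF that]] by (auto intro: null_sets_completionI)
  qed
  then have "(\<Union>l\<in>L. perturbed l -` ?N \<inter> space \<Omega>) \<in> null_sets (completion \<Omega>)"
    using L(1) by (intro null_sets.finite_UN) auto
  also have "(\<Union>l\<in>L. perturbed l -` ?N \<inter> space \<Omega>) = space \<Omega> - unique_event"
    using measurable_space[OF perturbed_law(1)] by (auto simp: unique_event_def)
  finally show ?thesis .
qed

lemma unique_event_sets: "unique_event \<in> sets (completion \<Omega>)"
proof -
  have "unique_event = space (completion \<Omega>) - (space \<Omega> - unique_event)"
    by (auto simp: unique_event_def)
  also have "\<dots> \<in> sets (completion \<Omega>)"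
    using non_unique_null by (intro sets.compl_sets) auto
  finally show ?thesis .
qed

text \<open>Preservation of the input law makes \<open>perturbed l\<close> measurable between the
  completions, and \<open>unique_event\<close> is mapped into the set on which the regularity
  assumption makes \<open>minimizer\<close> measurable.\<close>

lemma perturbed_minimizer_measurable:
  assumes "l \<in> L"
  shows "perturbed_minimizer l \<in> restrict_space (completion \<Omega>) unique_event \<rightarrow>\<^sub>M borel_of mtopology"
proof -
  have "perturbed l \<in> restrict_space (completion \<Omega>) unique_event \<rightarrow>\<^sub>M
      restrict_space (completion input_law) (unique_set P I S \<psi>)"
    using assms perturbed_law[OF assms]
    by (intro measurable_restrict_space3 measurable_completion_completion)
      (auto simp: unique_event_def)
  moreover have "minimizer S \<psi> \<in> restrict_space (completion input_law) (unique_set P I S \<psi>)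
      \<rightarrow>\<^sub>M borel_of mtopology"
    using regularity by (simp add: regularity_assumption_def)
  ultimately show ?thesis
    by (rule measurable_compose)
qed

lemma perturbed_minimizer_in_S: "l \<in> L \<Longrightarrow> w \<in> unique_event \<Longrightarrow> perturbed_minimizer l w \<in> S"
  using measurable_space[OF perturbed_minimizer_measurable, of l w]
  by (simp add: space_restrict_space unique_event_def)

text \<open>The part inside \<open>unique_event\<close> is a finite union of measurable sets; the
  rest is a subset of a null set, which the completion contains whatever the unspecified values
  are.\<close>

lemma far_event_sets: "far_event e \<in> sets (completion \<Omega>)"
proof -
  let ?R = "restrict_space (completion \<Omega>) unique_event"
  have R: "space ?R = unique_event"
    by (auto simp: space_restrict_space unique_event_def)
  have "{w \<in> unique_event. d (perturbed_minimizer l w) (\<omega>s l w) > e} \<in> sets (completion \<Omega>)"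
    if "l \<in> L" for l
  proof -
    have [measurable]: "(\<lambda>w. d (perturbed_minimizer l w) (\<omega>s l w)) \<in> borel_measurable ?R"
      using that guess_measurable_completion
      by (intro measurable_dist[OF compact] perturbed_minimizer_measurable
          measurable_restrict_space1)
    have "{w \<in> space ?R. d (perturbed_minimizer l w) (\<omega>s l w) > e} \<in> sets ?R"
      by measurable
    then show ?thesis
      using unique_event_sets unfolding R by (subst (asm) sets_restrict_space_iff) auto
  qed
  then have "(\<Union>l\<in>L. {w \<in> unique_event. d (perturbed_minimizer l w) (\<omega>s l w) > e})
      \<in> sets (completion \<Omega>)"
    using L(1) by auto
  also have "(\<Union>l\<in>L. {w \<in> unique_event. d (perturbed_minimizer l w) (\<omega>s l w) > e}) =
      far_event e \<inter> unique_event"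
    using L by (auto simp: far_event_def unique_event_def Max_gr_iff)
  finally have "far_event e \<inter> unique_event \<in> sets (completion \<Omega>)" .
  moreover have "far_event e - unique_event \<in> null_sets (completion \<Omega>)"
    by (rule null_sets_completion_subset[OF _ non_unique_null]) (auto simp: far_event_def)
  ultimately have "(far_event e \<inter> unique_event) \<union> (far_event e - unique_event)
      \<in> sets (completion \<Omega>)"
    by auto
  then show ?thesis
    by (simp add: Int_Diff_Un)
qed

lemma suboptimal_event_sets:
  assumes "l \<in> L"
  shows "suboptimal_event t l \<in> sets (completion \<Omega>)"
proof -
  have input: "input_vec I X \<in> completion \<Omega> \<rightarrow>\<^sub>M completion input_law"
    using input_vec_law by (rule measurable_completion_completion)
  have [measurable]: "(\<lambda>w. \<psi> (input_vec I X w) (\<omega>s l w)) \<in> borel_measurable (completion \<Omega>)"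
    using measurable_compose[OF measurable_Pair[OF input guess_measurable_completion[OF assms]]
        objective_measurable] by simp
  have [measurable]: "(\<lambda>w. opt_val S \<psi> (input_vec I X w)) \<in> borel_measurable (completion \<Omega>)"
    using regularity by (intro measurable_compose[OF input]) (auto simp: regularity_assumption_def)
  have "{w \<in> space (completion \<Omega>).
      ereal (\<psi> (input_vec I X w) (\<omega>s l w)) - opt_val S \<psi> (input_vec I X w) > ereal t}
      \<in> sets (completion \<Omega>)"
    by measurable
  then show ?thesis
    by (simp add: suboptimal_event_def)
qed

lemma near_optI:
  assumes "l \<in> L" "w \<in> space \<Omega>" "w \<notin> suboptimal_event t l"
  shows "\<omega>s l w \<in> near_opt_set S \<psi> t (input_vec I X w)"
proof -
  have "ereal (\<psi> (input_vec I X w) (\<omega>s l w)) - opt_val S \<psi> (input_vec I X w) \<le> ereal t"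
    using assms by (auto simp: suboptimal_event_def)
  then have "ereal (\<psi> (input_vec I X w) (\<omega>s l w)) \<le> opt_val S \<psi> (input_vec I X w) + ereal t"
    \<comment> \<open>An infimum of -\<infinity> contradicts the bound on the difference; the finite
      case is a rearrangement.\<close>
    by (cases "opt_val S \<psi> (input_vec I X w)") auto
  then show ?thesis
    using guess_in_S assms by (simp add: near_opt_set_def)
qed

lemma Min_packing_le:
  assumes \<epsilon>: "\<epsilon> > 0" and w: "w \<in> unique_event" and close: "w \<notin> far_event (\<epsilon> / 4)"
    and few: "real (card {l \<in> L. w \<in> suboptimal_event t l}) < \<epsilon> * card L"
  shows "(MIN A\<in>{A. A \<subseteq> L \<and> real (card A) > (1 - \<epsilon>) * real (card L)}.
      packing_number ((\<lambda>l. perturbed_minimizer l w) ` A) d \<epsilon>)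
    \<le> packing_number (near_opt_set S \<psi> t (input_vec I X w)) d (\<epsilon> / 2)"
proof -
  have w_space: "w \<in> space \<Omega>"
    using w by (simp add: unique_event_def)
  \<comment> \<open>The indices with near-optimal guesses: fewer than
    \<open>\<epsilon> * card L\<close> are left out, so this set competes in the minimum.\<close>
  define A where "A = {l \<in> L. w \<notin> suboptimal_event t l}"
  have "card L = card A + card {l \<in> L. w \<in> suboptimal_event t l}"
    unfolding A_def using L(1) by (subst card_Un_disjoint[symmetric]) (auto intro!: arg_cong[of _ _ card])
  then have "real (card A) > (1 - \<epsilon>) * real (card L)"
    using few by (simp add: algebra_simps)
  then have "(MIN A\<in>{A. A \<subseteq> L \<and> real (card A) > (1 - \<epsilon>) * real (card L)}.
      packing_number ((\<lambda>l. perturbed_minimizer l w) ` A) d \<epsilon>)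
    \<le> packing_number ((\<lambda>l. perturbed_minimizer l w) ` A) d \<epsilon>"
    using L(1) by (intro Min_le) (auto simp: A_def)
  also have "\<dots> \<le> packing_number (near_opt_set S \<psi> t (input_vec I X w)) d (\<epsilon> / 2)"
  proof (rule packing_number_image_le[where g = "\<lambda>l. \<omega>s l w", OF \<epsilon>])
    show "near_opt_set S \<psi> t (input_vec I X w) \<subseteq> S"
      by (auto simp: near_opt_set_def)
    fix l assume l: "l \<in> A"
    then show "perturbed_minimizer l w \<in> S"
      "\<omega>s l w \<in> near_opt_set S \<psi> t (input_vec I X w)"
      using w w_space perturbed_minimizer_in_S near_optI by (auto simp: A_def)
    have "d (perturbed_minimizer l w) (\<omega>s l w)
        \<le> (MAX l\<in>L. d (perturbed_minimizer l w) (\<omega>s l w))"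
      using L(1) l by (intro Max_ge) (auto simp: A_def)
    also have "\<dots> \<le> \<epsilon> / 4"
      using close w_space by (auto simp: far_event_def)
    finally show "d (perturbed_minimizer l w) (\<omega>s l w) \<le> \<epsilon> / 4" .
  qed
  finally show ?thesis .
qed

text \<open>A union bound: outside a cover of the tail event of the near-optimal packing number, the
  far event, the event of too many suboptimal guesses and the null event of non-uniqueness, the
  minimum is at most \<open>K\<close>. The threshold \<open>Suc K\<close> turns the strict tail of
  tightness into the weak inequality of stability.\<close>

lemma measure_large_packing_le:
  assumes \<epsilon>: "\<epsilon> > 0" and \<eta>: "\<eta> \<ge> 0"
    and tight: "outer_measure_of \<Omega> {w \<in> space \<Omega>.
      packing_number (near_opt_set S \<psi> t (input_vec I X w)) d (\<epsilon> / 2) > enat K} \<le> ennreal \<eta>"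
  shows "measure (completion \<Omega>) {w \<in> space \<Omega>.
      (MIN A\<in>{A. A \<subseteq> L \<and> real (card A) > (1 - \<epsilon>) * real (card L)}.
        packing_number ((\<lambda>l. perturbed_minimizer l w) ` A) d \<epsilon>) \<ge> enat (Suc K)}
    \<le> \<eta> + measure (completion \<Omega>) (far_event (\<epsilon> / 4))
        + (1 / card L * (\<Sum>l\<in>L. measure (completion \<Omega>) (suboptimal_event t l))) / \<epsilon>"
    (is "measure _ ?E \<le> _")
proof -
  \<comment> \<open>The suboptimal events are shown measurable only for the completion, so Markov's
    bound is applied there.\<close>
  interpret C: prob_space "completion \<Omega>"
    by (rule prob_spaceI) (simp add: \<Omega>.emeasure_space_1)
  \<comment> \<open>Tightness bounds an outer measure; a measurable cover of equal measure allows it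
    to enter the union bound.\<close>
  obtain B where B: "B \<in> sets \<Omega>" "emeasure \<Omega> B \<le> ennreal \<eta>"
    "{w \<in> space \<Omega>. packing_number (near_opt_set S \<psi> t (input_vec I X w)) d (\<epsilon> / 2) > enat K} \<subseteq> B"
    using outer_measure_of_attain[of "{w \<in> space \<Omega>.
      packing_number (near_opt_set S \<psi> t (input_vec I X w)) d (\<epsilon> / 2) > enat K}" \<Omega>] tight
    by auto
  have measure_B: "measure (completion \<Omega>) B \<le> \<eta>"
    using B \<eta> by (simp add: \<Omega>.emeasure_eq_measure)
  define F where
    "F = {w \<in> space \<Omega>. real (card {l \<in> L. w \<in> suboptimal_event t l}) \<ge> \<epsilon> * card L}"
  have F: "F \<in> sets (completion \<Omega>)" "measure (completion \<Omega>) F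
      \<le> (1 / card L * (\<Sum>l\<in>L. measure (completion \<Omega>) (suboptimal_event t l))) / \<epsilon>"
    using C.prob_card_members_ge_le[OF L \<epsilon>, of "suboptimal_event t"] suboptimal_event_sets by (simp_all add: F_def)
  have "?E \<subseteq> ((B \<union> far_event (\<epsilon> / 4)) \<union> F) \<union> (space \<Omega> - unique_event)"
  proof (rule subsetI, rule ccontr)
    fix w assume "w \<in> ?E"
      and "w \<notin> ((B \<union> far_event (\<epsilon> / 4)) \<union> F) \<union> (space \<Omega> - unique_event)"
    then have w: "w \<in> space \<Omega>" "w \<in> unique_event" "w \<notin> (B \<union> far_event (\<epsilon> / 4)) \<union> F"
      and large: "enat (Suc K) \<le> (MIN A\<in>{A. A \<subseteq> L \<and> real (card A) > (1 - \<epsilon>) * real (card L)}.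
        packing_number ((\<lambda>l. perturbed_minimizer l w) ` A) d \<epsilon>)"
      by auto
    note large
    also have "\<dots> \<le> packing_number (near_opt_set S \<psi> t (input_vec I X w)) d (\<epsilon> / 2)"
      using w \<epsilon> by (intro Min_packing_le) (auto simp: F_def)
    also have "\<dots> \<le> enat K"
      using w B(3) by force
    finally show False by simp
  qed
  then have "measure (completion \<Omega>) ?E
      \<le> measure (completion \<Omega>) (((B \<union> far_event (\<epsilon> / 4)) \<union> F) \<union> (space \<Omega> - unique_event))"
    using B(1) F(1) far_event_sets null_setsD2[OF non_unique_null]
    by (intro C.finite_measure_mono sets.Un) auto
  also have "\<dots> = measure (completion \<Omega>) ((B \<union> far_event (\<epsilon> / 4)) \<union> F)"
    using B(1) F(1) far_event_sets non_unique_null by (intro measure_Un_null_set) auto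
  also have "\<dots> \<le> measure (completion \<Omega>) (B \<union> far_event (\<epsilon> / 4)) + measure (completion \<Omega>) F"
    using B(1) F(1) far_event_sets by (intro measure_Un_le) auto
  also have "\<dots> \<le> (measure (completion \<Omega>) B + measure (completion \<Omega>) (far_event (\<epsilon> / 4)))
      + measure (completion \<Omega>) F"
    using B(1) far_event_sets by (intro add_right_mono measure_Un_le) auto
  finally show ?thesis
    using measure_B F(2) by linarith
qed

end

section \<open>Stability in the limit\<close>

theorem theorem1p4p8:
  fixes P :: "'x measure"
    and I :: "nat \<Rightarrow> 'i set"
    and S :: "nat \<Rightarrow> 's set"
    and d :: "nat \<Rightarrow> 's \<Rightarrow> 's \<Rightarrow> real"
    and \<psi> :: "nat \<Rightarrow> ('i \<Rightarrow> 'x) \<Rightarrow> 's \<Rightarrow> real"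
    and L :: "nat \<Rightarrow> 'l set"
    and J :: "nat \<Rightarrow> 'l \<Rightarrow> 'i set"
    and \<Omega> :: "nat \<Rightarrow> 'w measure"
    and X :: "nat \<Rightarrow> 'i \<Rightarrow> 'w \<Rightarrow> 'x"
    and X' :: "nat \<Rightarrow> 'l \<Rightarrow> 'i \<Rightarrow> 'w \<Rightarrow> 'x"
    and \<theta> :: "nat \<Rightarrow> real"
    and \<omega>s :: "nat \<Rightarrow> 'l \<Rightarrow> 'w \<Rightarrow> 's"
  assumes problem: "\<And>n. n \<ge> 1 \<Longrightarrow> random_min_problem P (I n) (S n) (d n) (\<psi> n)"
    and diam: "\<exists>B. \<forall>n\<ge>1. \<forall>x\<in>S n. \<forall>y\<in>S n. d n x y \<le> B"
    and uniqueness: "\<And>n. n \<ge> 1 \<Longrightarrow> uniqueness_assumption P (I n) (S n) (\<psi> n)"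
    and regularity: "\<And>n. n \<ge> 1 \<Longrightarrow> regularity_assumption P (I n) (S n) (d n) (\<psi> n)"
    and prob: "\<And>n. n \<ge> 1 \<Longrightarrow> prob_space (\<Omega> n)"
    and inputs: "\<And>n. n \<ge> 1 \<Longrightarrow> iid_inputs (\<Omega> n) P (I n) (X n)"
    and blocks: "\<And>n. n \<ge> 1 \<Longrightarrow> perturbation_blocks (I n) (L n) (J n)"
    and copies: "\<And>n l. n \<ge> 1 \<Longrightarrow> l \<in> L n \<Longrightarrow> independent_copy (\<Omega> n) P (I n) (X n) (X' n l)"
    and theta_pos: "\<And>n. n \<ge> 1 \<Longrightarrow> \<theta> n > 0"
    and A: "\<And>c \<epsilon>::real. c > 0 \<Longrightarrow> \<epsilon> > 0 \<Longrightarrow>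
        tight_sequence \<Omega>
          (\<lambda>n w. packing_number
             (near_opt_set (S n) (\<psi> n) (c * \<theta> n) (input_vec (I n) (X n) w)) (d n) \<epsilon>)"
    and B_measurable: "\<And>n l. n \<ge> 1 \<Longrightarrow> l \<in> L n \<Longrightarrow>
        \<omega>s n l \<in> perturbation_algebra (\<Omega> n) P (I n) (L n) (J n) (X n) (X' n)
                  \<rightarrow>\<^sub>M borel_of (Metric_space.mtopology (S n) (d n))"
    and B_close: "\<And>\<epsilon>::real. \<epsilon> > 0 \<Longrightarrow>
        (\<lambda>n. measure (completion (\<Omega> n))
           {w \<in> space (\<Omega> n).
              (MAX l\<in>L n. d n (minimizer (S n) (\<psi> n)
                                 (perturbed_vec (I n) (J n l) (X n) (X' n l) w)) (\<omega>s n l w)) > \<epsilon>})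
          \<longlonglongrightarrow> 0"
    and B_near_opt:
        "((\<lambda>c::real. limsup (\<lambda>n. ereal (1 / real (card (L n)) *
             (\<Sum>l\<in>L n. measure (completion (\<Omega> n))
                {w \<in> space (\<Omega> n).
                   ereal (\<psi> n (input_vec (I n) (X n) w) (\<omega>s n l w))
                     - opt_val (S n) (\<psi> n) (input_vec (I n) (X n) w) > ereal (c * \<theta> n)}))))
           \<longlongrightarrow> 0) at_top"
  shows "stable_under_small_perturbations \<Omega> I S d \<psi> L J X X'"
proof -
  have loc: "perturbed_problem P (I n) (S n) (d n) (\<psi> n) (\<Omega> n) (L n) (J n) (X n) (X' n) (\<omega>s n)"
    if "n \<ge> 1" for n
    unfolding perturbed_problem_def perturbed_problem_axioms_def
    using that problem uniqueness regularity prob inputs blocks copies B_measurable by blast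
  show ?thesis
    unfolding stable_under_small_perturbations_def
  proof (intro allI impI)
    fix \<epsilon> \<delta> :: real assume \<epsilon>: "\<epsilon> > 0" and \<delta>: "\<delta> > 0"
    define avg where "avg c n = 1 / real (card (L n)) * (\<Sum>l\<in>L n. measure (completion (\<Omega> n))
        {w \<in> space (\<Omega> n). ereal (\<psi> n (input_vec (I n) (X n) w) (\<omega>s n l w))
           - opt_val (S n) (\<psi> n) (input_vec (I n) (X n) w) > ereal (c * \<theta> n)})" for c n
    \<comment> \<open>Markov's inequality divides the average by \<epsilon>, so the bound
      \<epsilon>\<delta>/4 contributes \<delta>/4. With \<delta>/4 each from tightness and from
      closeness of the guesses, the total stays below \<delta>.\<close>
    have "\<forall>\<^sub>F c in at_top. limsup (\<lambda>n. ereal (avg c n)) < ereal (\<epsilon> * \<delta> / 4)"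
      using \<epsilon> \<delta> unfolding avg_def by (intro order_tendstoD(2)[OF B_near_opt]) simp
    then have "\<forall>\<^sub>F c in at_top. limsup (\<lambda>n. ereal (avg c n)) < ereal (\<epsilon> * \<delta> / 4) \<and> c > 0"
      using eventually_gt_at_top[of "0::real"] by eventually_elim auto
    then obtain c where c: "c > 0" "limsup (\<lambda>n. ereal (avg c n)) < ereal (\<epsilon> * \<delta> / 4)"
      using eventually_happens[of _ "at_top :: real filter"] by auto
    \<comment> \<open>\<open>K\<close> is chosen after \<open>c\<close> and uniformly in n, at the
      scale \<epsilon>/2 at which the guesses are separated.\<close>
    obtain K where K: "\<And>n. n \<ge> 1 \<Longrightarrow> outer_measure_of (\<Omega> n) {w \<in> space (\<Omega> n).
        packing_number (near_opt_set (S n) (\<psi> n) (c * \<theta> n) (input_vec (I n) (X n) w))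
          (d n) (\<epsilon> / 2) > enat K} \<le> ennreal (\<delta> / 4)"
      using A[OF c(1), of "\<epsilon> / 2", unfolded tight_sequence_def, rule_format, of "\<delta> / 4"] \<epsilon> \<delta>
      by auto
    have "\<forall>\<^sub>F n in sequentially. avg c n < \<epsilon> * \<delta> / 4"
      using Limsup_lessD[OF c(2)] by simp
    moreover have "\<forall>\<^sub>F n in sequentially. measure (completion (\<Omega> n)) {w \<in> space (\<Omega> n).
        (MAX l\<in>L n. d n (minimizer (S n) (\<psi> n) (perturbed_vec (I n) (J n l) (X n) (X' n l) w))
          (\<omega>s n l w)) > \<epsilon> / 4} < \<delta> / 4"
      using \<epsilon> \<delta> by (intro order_tendstoD(2)[OF B_close]) auto
    ultimately have "\<forall>\<^sub>F n in sequentially. measure (completion (\<Omega> n))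
          {w \<in> space (\<Omega> n).
             (MIN A\<in>{A. A \<subseteq> L n \<and> real (card A) > (1 - \<epsilon>) * real (card (L n))}.
                packing_number
                  ((\<lambda>l. minimizer (S n) (\<psi> n) (perturbed_vec (I n) (J n l) (X n) (X' n l) w)) ` A)
                  (d n) \<epsilon>) \<ge> enat (Suc K)} \<le> \<delta>"
      using eventually_ge_at_top[of "1::nat"]
    proof eventually_elim
      case (elim n)
      interpret perturbed_problem P "I n" "S n" "d n" "\<psi> n" "\<Omega> n" "L n" "J n" "X n" "X' n" "\<omega>s n"
        using elim(3) by (rule loc)
      have "avg c n / \<epsilon> \<le> \<delta> / 4"
        using elim(1) \<epsilon> by (simp add: field_simps)
      then show ?case
        using measure_large_packing_le[OF \<epsilon> _ K[OF elim(3)]] elim(2) \<delta>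
        unfolding far_event_def suboptimal_event_def avg_def by linarith
    qed
    then show "\<exists>K::nat. limsup (\<lambda>n. ereal (measure (completion (\<Omega> n))
          {w \<in> space (\<Omega> n).
             (MIN A\<in>{A. A \<subseteq> L n \<and> real (card A) > (1 - \<epsilon>) * real (card (L n))}.
                packing_number
                  ((\<lambda>l. minimizer (S n) (\<psi> n) (perturbed_vec (I n) (J n l) (X n) (X' n l) w)) ` A)
                  (d n) \<epsilon>) \<ge> enat K})) \<le> ereal \<delta>"
      by (intro exI[of _ "Suc K"] Limsup_bounded) simp
  qed
qed

end
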